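(* Assume $[0,1]\subseteq I\subseteq\mathbb{R}_+$ or $I=\mathbb{R}$. Let $f\colon I^n\to\mathbb{R}$ be a function and let $f_0=f-f(\mathbf{0})$. Then $f$ is a Lovász extension if and only if the following conditions hold: (i) $f_0$ is comonotonically additive or horizontally min-additive (or horizontally max-additive if $I=\mathbb{R}$). (ii) Each of the maps $\delta_{f_0}$ and $\delta_{f_0}^A|_{I_+}$ $(A\subseteq[n])$ is continuous at a point or monotonic or Lebesgue measurable or bounded from one side on a set of positive measure. If $I=\mathbb{R}$, then the set $I_+$ can be replaced by $I_-$ in (ii). Finally, Condition (ii) holds whenever Condition (i) holds and $\delta_{f_0}^A$ is positively homogeneous of degree one for every $A\subseteq[n]$.
   Context: $n\geq 1$ is an integer, $[n]=\{1,\ldots,n\}$, $S_n$ is the set of permutations of $[n]$, and $I$ is a real interval, possibly unbounded. $\mathbb{R}_+=[0,+\infty[$, $\mathbb{R}_-=\,]-\infty,0]$, $I_+=I\cap\mathbb{R}_+$, $I_-=I\cap\mathbb{R}_-$, $\mathbf{0}=(0,\ldots,0)$. For $\sigma\in S_n$, $\mathbb{R}^n_\sigma=\{\mathbf{x}\in\mathbb{R}^n : x_{\sigma(1)}\leq\cdots\leq x_{\sigma(n)}\}$ and $I^n_\sigma=I^n\cap\mathbb{R}^n_\sigma$. For $A\subseteq[n]$, $\mathbf{1}_A$ is the $n$-tuple whose $i$th component is $1$ if $i\in A$ and $0$ otherwise; for $g\colon I^n\to\mathbb{R}$, $\delta_g^A\colon I\to\mathbb{R}$ is defined by $\delta_g^A(x)=g(x\mathbf{1}_A)$,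 and $\delta_g=\delta_g^{[n]}$. A function $u\colon I\to\mathbb{R}$ is positively homogeneous of degree one if $u(cx)=c\,u(x)$ for every $x\in I$ and every $c>0$ such that $cx\in I$. Lovász extensions: for $\phi\colon\{0,1\}^n\to\mathbb{R}$, the Lovász extension $f_\phi\colon\mathbb{R}^n\to\mathbb{R}$ of $\phi$ is the function whose restriction to each $\mathbb{R}^n_\sigma$ ($\sigma\in S_n$) is the unique affine function agreeing with $\phi$ at the $n+1$ vertices of the simplex $[0,1]^n\cap\mathbb{R}^n_\sigma$. A function $\mathbb{R}^n\to\mathbb{R}$ is a Lovász extension if it equals $f_\phi$ for some $\phi$. A function $f\colon I^n\to\mathbb{R}$ is a Lovász extension if it is the restriction to $I^n$ of a Lovász extension on $\mathbb{R}^n$. Two $n$-tuples $\mathbf{x},\mathbf{x}'\in I^n$ are comonotonic if there is $\sigma\in S_n$ such that $\mathbf{x},\mathbf{x}'\in I^n_\sigma$. A function $g\colon I^n\to\mathbb{R}$ is comonotonically additive if $g(\mathbf{x}+\mathbf{x}')=g(\mathbf{x})+g(\mathbf{x}')$ for all comonotonic $\mathbf{x},\mathbf{x}'\in I^n$ such that $\mathbf{x}+\mathbf{x}'\in I^n$. For $\mathbf{x}\in I^n$ and $c\in I$, $\mathbf{x}\wedge c$ (resp. $\mathbf{x}\vee c$) is the $n$-tuple whose $i$th component is $\min(x_i,c)$ (resp. $\max(x_i,c)$); put $[\mathbf{x}]_c=\mathbf{x}-(\mathbf{x}\wedge c)$ and $[\mathbf{x}]^c=\mathbf{x}-(\mathbf{x}\vee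 c)$. A function $g\colon I^n\to\mathbb{R}$ is horizontally min-additive if $g(\mathbf{x})=g(\mathbf{x}\wedge c)+g([\mathbf{x}]_c)$ for every $\mathbf{x}\in I^n$ and every $c\in I$ such that $[\mathbf{x}]_c\in I^n$. It is horizontally max-additive if $g(\mathbf{x})=g(\mathbf{x}\vee c)+g([\mathbf{x}]^c)$ for every $\mathbf{x}\in I^n$ and every $c\in I$ such that $[\mathbf{x}]^c\in I^n$. *)

theory Defs
  imports "HOL-Analysis.Analysis"
begin

text \<open>The index set is a finite linearly ordered type, playing the role of the chain
  \<open>1 < ... < n\<close>; a function on a subset of \<open>real ^ 'n\<close> is a total function of which
  only the values on that subset are used.\<close>

definition cart_power :: "real set \<Rightarrow> (real ^ 'n) set" where
  "cart_power I = {x. \<forall>i. x $ i \<in> I}"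

definition order_cone :: "('n \<Rightarrow> 'n) \<Rightarrow> (real ^ 'n::{finite,linorder}) set" where
  "order_cone \<sigma> = {x. \<forall>i j. i \<le> j \<longrightarrow> x $ \<sigma> i \<le> x $ \<sigma> j}"

definition indicator_vec :: "'n set \<Rightarrow> real ^ 'n" where
  "indicator_vec A = (\<chi> i. if i \<in> A then 1 else 0)"

definition delta :: "(real ^ 'n \<Rightarrow> real) \<Rightarrow> 'n set \<Rightarrow> real \<Rightarrow> real" where
  "delta g A x = g (x *\<^sub>R indicator_vec A)"

definition pos_homogeneous_on :: "real set \<Rightarrow> (real \<Rightarrow> real) \<Rightarrow> bool" where
  "pos_homogeneous_on I u \<longleftrightarrow> (\<forall>x\<in>I. \<forall>c>0. c * x \<in> I \<longrightarrow> u (c * x) = c * u x)"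

definition affine_fun :: "(real ^ 'n \<Rightarrow> real) \<Rightarrow> bool" where
  "affine_fun g \<longleftrightarrow> (\<exists>h b. linear h \<and> (\<forall>x. g x = h x + b))"

text \<open>The vertices of the simplices below lie in \<open>{0,1}^n\<close>, so only the values of
  \<open>\<phi>\<close> there matter. They are affinely independent, so \<open>g\<close> is unique and
  \<open>\<phi>\<close> has exactly one Lovasz extension.\<close>

definition lovasz_extension_of ::
  "(real ^ 'n::{finite,linorder} \<Rightarrow> real) \<Rightarrow> (real ^ 'n::{finite,linorder} \<Rightarrow> real) \<Rightarrow> bool" where
  "lovasz_extension_of \<phi> F \<longleftrightarrow>
     (\<forall>\<sigma>. \<sigma> permutes UNIV \<longrightarrow>
        (\<exists>g. affine_fun g \<and>
             (\<forall>v. v extreme_point_of (cart_power {0..1} \<inter> order_cone \<sigma>) \<longrightarrow> g v = \<phi> v) \<and>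
             (\<forall>x\<in>order_cone \<sigma>. F x = g x)))"

definition lovasz_extension_on ::
  "real set \<Rightarrow> (real ^ 'n::{finite,linorder} \<Rightarrow> real) \<Rightarrow> bool" where
  "lovasz_extension_on I f \<longleftrightarrow>
     (\<exists>\<phi> F. lovasz_extension_of \<phi> F \<and> (\<forall>x\<in>cart_power I. f x = F x))"

definition comonotonic :: "real ^ 'n::{finite,linorder} \<Rightarrow> real ^ 'n::{finite,linorder} \<Rightarrow> bool" where
  "comonotonic x y \<longleftrightarrow> (\<exists>\<sigma>. \<sigma> permutes UNIV \<and> x \<in> order_cone \<sigma> \<and> y \<in> order_cone \<sigma>)"

definition comonotonically_additive ::
  "real set \<Rightarrow> (real ^ 'n::{finite,linorder} \<Rightarrow> real) \<Rightarrow> bool" where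
  "comonotonically_additive I g \<longleftrightarrow>
     (\<forall>x\<in>cart_power I. \<forall>y\<in>cart_power I.
        comonotonic x y \<and> x + y \<in> cart_power I \<longrightarrow> g (x + y) = g x + g y)"

definition min_const :: "real ^ 'n \<Rightarrow> real \<Rightarrow> real ^ 'n" where
  "min_const x c = (\<chi> i. min (x $ i) c)"

definition max_const :: "real ^ 'n \<Rightarrow> real \<Rightarrow> real ^ 'n" where
  "max_const x c = (\<chi> i. max (x $ i) c)"

definition horizontally_min_additive :: "real set \<Rightarrow> (real ^ 'n \<Rightarrow> real) \<Rightarrow> bool" where
  "horizontally_min_additive I g \<longleftrightarrow>
     (\<forall>x\<in>cart_power I. \<forall>c\<in>I. x - min_const x c \<in> cart_power I \<longrightarrow>
        g x = g (min_const x c) + g (x - min_const x c))"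

definition horizontally_max_additive :: "real set \<Rightarrow> (real ^ 'n \<Rightarrow> real) \<Rightarrow> bool" where
  "horizontally_max_additive I g \<longleftrightarrow>
     (\<forall>x\<in>cart_power I. \<forall>c\<in>I. x - max_const x c \<in> cart_power I \<longrightarrow>
        g x = g (max_const x c) + g (x - max_const x c))"

text \<open>The second argument stands for its restriction to \<open>D\<close>: continuity, monotonicity and
  measurability are all relative to \<open>D\<close>.\<close>

definition weakly_regular_on :: "real set \<Rightarrow> (real \<Rightarrow> real) \<Rightarrow> bool" where
  "weakly_regular_on D u \<longleftrightarrow>
     (\<exists>x\<in>D. continuous (at x within D) u) \<or>
     (mono_on D u \<or> antimono_on D u) \<or>
     u \<in> borel_measurable (lebesgue_on D) \<or>
     (\<exists>S\<in>sets lebesgue. S \<subseteq> D \<and> emeasure lebesgue S > 0 \<and>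
        ((\<exists>M. \<forall>x\<in>S. u x \<le> M) \<or> (\<exists>M. \<forall>x\<in>S. M \<le> u x)))"

definition condition_i :: "real set \<Rightarrow> (real ^ 'n::{finite,linorder} \<Rightarrow> real) \<Rightarrow> bool" where
  "condition_i I g \<longleftrightarrow>
     comonotonically_additive I g \<or> horizontally_min_additive I g \<or>
     (I = UNIV \<and> horizontally_max_additive I g)"

text \<open>Here \<open>J\<close> is the half of \<open>I\<close> (nonnegative or nonpositive) to which the maps indexed
  by arbitrary \<open>A\<close> are restricted.\<close>

definition condition_ii :: "real set \<Rightarrow> real set \<Rightarrow> (real ^ 'n \<Rightarrow> real) \<Rightarrow> bool" where
  "condition_ii I J g \<longleftrightarrow>
     weakly_regular_on I (delta g UNIV) \<and> (\<forall>A. weakly_regular_on J (delta g A))"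

end

theory Submission imports Defs begin

text \<open>
  Write \<open>g = f - f 0\<close>. Being a Lovasz extension means exactly that \<open>g\<close> coincides with a
  linear map on every order cone (\<open>lovasz_extension_on_iff_conewise_linear\<close>): the linear
  pieces match on overlaps because overlaps can be moved into the unit cube, where all pieces
  equal \<open>g\<close>. The easy direction follows at once. Comonotonic points share a cone, and rays
  through \<open>\<plusminus> indicator_vec A\<close> stay inside one cone, so the sections \<open>delta g A\<close> are linear on each
  half-line.

  For the converse, comonotonic additivity implies horizontal min-additivity, because the two
  parts of a cut are comonotonic. Cutting a nonnegative point again and again at its smallest
  positive coordinate writes it as a nonnegative combination of indicators of a chain of upper
  level sets; for a general point a constant vector is cut off first. Along this decomposition, \<open>g\<close> is additive. Hence \<open>g\<close> is linear on every cone as soon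
  as the sections \<open>delta g A\<close> are linear on the nonnegative part of the interval
  (\<open>horizontally_min_additive_imp_conewise_linear\<close>).

  The sections are additive on nonnegative arguments, so the question becomes Cauchy's
  functional equation. Each of the regularity alternatives yields a one-sided bound on a set of
  positive measure, and an additive function with such a bound is linear
  (\<open>additive_bounded_above_imp_linear\<close>), by a symmetrization of the set followed by
  Steinhaus' argument. If regularity is given on the nonpositive half-line, the identity
  \<open>delta g A r = delta g UNIV r + delta g (- A) (- r)\<close> for \<open>r \<le> 0\<close> transports it
  (\<open>delta_linear_of_nonpos_regular\<close>). Horizontal max-additivity is reduced to the
  min-additive case by the reflection \<open>x \<mapsto> - x\<close>.

  Finally, a positively homogeneous section is linear on \<open>[0,1]\<close>, hence bounded there, which is
  one of the regularity alternatives.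
\<close>

section \<open>Additive functions bounded on one side of a nonnull set\<close>

text \<open>Compactness is what lets the later measure arguments control a set by its small open
  neighbourhoods, and lets all integrals be taken over Borel sets.\<close>

lemma nonnull_imp_nonnull_compact:
  fixes S :: "real set"
  assumes S: "S \<in> sets lebesgue" "emeasure lebesgue S > 0"
  obtains K where "compact K" "K \<subseteq> S" "emeasure lebesgue K > 0"
proof -
  let ?S = "\<lambda>n::nat. S \<inter> {- real n..real n}"
  have "\<exists>n. emeasure lebesgue (?S n) > 0"
  proof (rule ccontr)
    assume "\<nexists>n. emeasure lebesgue (?S n) > 0"
    then have "emeasure lebesgue (?S n) = 0" for n by (simp add: not_gr_zero)
    moreover have "range ?S \<subseteq> sets lebesgue" using S(1) by auto
    ultimately have "emeasure lebesgue (\<Union>n. ?S n) = 0" by (intro emeasure_UN_eq_0) auto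
    moreover have "(\<Union>n. ?S n) = S"
    proof safe
      fix x assume "x \<in> S"
      obtain n where "\<bar>x\<bar> \<le> real n" using real_arch_simple by blast
      then show "x \<in> (\<Union>n. ?S n)" using \<open>x \<in> S\<close> by (auto simp: abs_le_iff intro!: exI[of _ n])
    qed
    ultimately show False using S(2) by simp
  qed
  then obtain n where n: "emeasure lebesgue (?S n) > 0" ..
  have fin: "emeasure lebesgue (?S n) \<noteq> \<infinity>"
  proof -
    have "emeasure lebesgue (?S n) \<le> emeasure lebesgue {- real n..real n}"
      by (intro emeasure_mono) auto
    then show ?thesis by (auto simp: top_unique)
  qed
  define e where "e = measure lebesgue (?S n)"
  have e: "emeasure lebesgue (?S n) = ennreal e"
    using fin by (simp add: e_def emeasure_eq_ennreal_measure)
  then have "e > 0" using n by simp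
  have Sl: "?S n \<in> sets lebesgue" using S(1) by auto
  then obtain K where K: "closed K" "K \<subseteq> ?S n" "?S n - K \<in> lmeasurable"
      "emeasure lebesgue (?S n - K) < ennreal e"
    using sets_lebesgue_inner_closed \<open>e > 0\<close> by blast
  then have Kl: "K \<in> sets lebesgue" by simp
  have "bounded K" using K(2) bounded_subset[OF bounded_closed_interval] by blast
  then have "compact K" using K(1) by (simp add: compact_eq_bounded_closed)
  moreover have "emeasure lebesgue K > 0"
  proof (rule ccontr)
    assume "\<not> emeasure lebesgue K > 0"
    then have "emeasure lebesgue K = 0" by (simp add: not_gr_zero)
    moreover have "emeasure lebesgue (?S n) \<le> emeasure lebesgue (K \<union> (?S n - K))"
      by (intro emeasure_mono sets.Un sets.Diff Kl Sl) auto
    moreover have "\<dots> \<le> emeasure lebesgue K + emeasure lebesgue (?S n - K)"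
      by (intro emeasure_subadditive sets.Diff Kl Sl)
    ultimately show False using K(4) e by simp
  qed
  ultimately show ?thesis using K(2) that by blast
qed

text \<open>The convolution of the indicator of \<open>K\<close> with itself has integral \<open>|K|^2 > 0\<close> by
  Tonelli, so it is nonzero at some \<open>p\<close>; its value there is the measure of
  \<open>K \<inter> (p - K)\<close>. On this set, which is stable under \<open>x \<mapsto> p - x\<close>, an upper bound for an
  additive function is also a lower bound.\<close>

lemma nonnull_imp_symmetric_nonnull:
  fixes K :: "real set"
  assumes K: "compact K" "emeasure lebesgue K > 0"
  obtains p where "emeasure lebesgue (K \<inter> (\<lambda>x. p - x) ` K) > 0"
proof -
  have [measurable]: "K \<in> sets borel" using K(1) by (simp add: borel_compact)
  have pos: "emeasure lborel K > 0" using K(2) by simp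
  let ?f = "\<lambda>x y. indicator K x * indicator K (y - x) :: ennreal"
  have inner: "(\<integral>\<^sup>+y. ?f x y \<partial>lborel) = indicator K x * emeasure lborel K" for x
  proof -
    have "(\<integral>\<^sup>+y. indicator K (y - x) \<partial>lborel) = (\<integral>\<^sup>+y. indicator K y \<partial>lborel)"
      using nn_integral_real_affine[of "indicator K" 1 "- x"] by (simp add: algebra_simps)
    then show ?thesis by (subst nn_integral_cmult) auto
  qed
  have "(\<integral>\<^sup>+y. (\<integral>\<^sup>+x. ?f x y \<partial>lborel) \<partial>lborel) = (\<integral>\<^sup>+x. (\<integral>\<^sup>+y. ?f x y \<partial>lborel) \<partial>lborel)"
    by (rule lborel_pair.Fubini') measurable
  also have "\<dots> = emeasure lborel K * emeasure lborel K"
    by (simp add: inner nn_integral_multc)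
  also have "\<dots> > 0" using pos by (simp add: ennreal_zero_less_mult_iff)
  finally have "(\<integral>\<^sup>+y. (\<integral>\<^sup>+x. ?f x y \<partial>lborel) \<partial>lborel) \<noteq> 0" by simp
  then obtain p where p: "(\<integral>\<^sup>+x. ?f x p \<partial>lborel) \<noteq> 0"
    by (metis (no_types, lifting) nn_integral_0_iff_AE nn_integral_cong nn_integral_const mult_zero_left)
  have "?f x p = indicator (K \<inter> (\<lambda>x. p - x) ` K) x" for x
    by (auto simp: indicator_def image_iff algebra_simps intro!: bexI[of _ "p - x"])
  moreover have "compact (K \<inter> (\<lambda>x. p - x) ` K)"
    using K(1) by (intro compact_Int compact_continuous_image continuous_intros)
  then have m: "K \<inter> (\<lambda>x. p - x) ` K \<in> sets borel" by (simp add: borel_compact)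
  ultimately have "(\<integral>\<^sup>+x. ?f x p \<partial>lborel) = emeasure lborel (K \<inter> (\<lambda>x. p - x) ` K)"
    by simp
  then have "emeasure lebesgue (K \<inter> (\<lambda>x. p - x) ` K) > 0"
    using p m by (simp add: zero_less_iff_neq_zero)
  then show ?thesis using that by blast
qed

text \<open>Steinhaus: an open \<open>U\<close> around \<open>K\<close> with \<open>|U - K| < |K|\<close> contains every sufficiently small
  translate of \<open>K\<close>, and such a translate is too large to avoid \<open>K\<close>.\<close>

lemma compact_nonnull_differences:
  fixes K :: "real set"
  assumes K: "compact K" "emeasure lebesgue K > 0"
  obtains e where "e > 0" "\<And>t. \<bar>t\<bar> < e \<Longrightarrow> \<exists>s\<in>K. t + s \<in> K"
proof -
  have fin: "emeasure lebesgue K < \<infinity>" using emeasure_compact_finite[OF K(1)] K(1) by (simp add: borel_compact)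
  have Kl: "K \<in> sets lebesgue" using K(1) by (simp add: borel_compact)
  define m where "m = measure lebesgue K"
  have m: "emeasure lebesgue K = ennreal m"
    using fin by (simp add: m_def emeasure_eq_ennreal_measure)
  then have "m > 0" using K(2) by simp
  obtain U where U: "open U" "K \<subseteq> U" "U - K \<in> lmeasurable" "emeasure lebesgue (U - K) < ennreal m"
    using sets_lebesgue_outer_open[OF Kl \<open>m > 0\<close>] .
  obtain e where e: "e > 0" "\<And>x y. x \<in> K \<Longrightarrow> y \<notin> U \<Longrightarrow> e \<le> dist x y"
    using separate_compact_closed[of K "- U"] K(1) U(1,2) by (force simp: closed_Compl)
  show ?thesis
  proof (rule that[OF e(1)])
    fix t :: real assume t: "\<bar>t\<bar> < e"
    show "\<exists>s\<in>K. t + s \<in> K"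
    proof (rule ccontr)
      assume no: "\<not> (\<exists>s\<in>K. t + s \<in> K)"
      have "t + s \<in> U" if "s \<in> K" for s
        using e(2)[OF that, of "t + s"] t by (force simp: dist_real_def)
      then have "(+) t ` K \<subseteq> U - K" using no by auto
      then have "emeasure lebesgue ((+) t ` K) \<le> emeasure lebesgue (U - K)"
        using U(3) by (intro emeasure_mono) auto
      moreover have "emeasure lebesgue ((+) t ` K) = emeasure lebesgue K"
        using emeasure_lebesgue_affine[of 1 t K] by (simp add: add.commute[of t])
      ultimately show False using U(4) m by simp
    qed
  qed
qed

text \<open>The last alternative of \<^const>\<open>weakly_regular_on\<close>. On an interval with more than one point
  every other alternative implies it, and it is the form in which regularity meets additivity.\<close>

definition one_sided_bounded_on_nonnull :: "real set \<Rightarrow> (real \<Rightarrow> real) \<Rightarrow> bool" where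
  "one_sided_bounded_on_nonnull D u \<longleftrightarrow>
     (\<exists>S\<in>sets lebesgue. S \<subseteq> D \<and> emeasure lebesgue S > 0 \<and>
        ((\<exists>M. \<forall>x\<in>S. u x \<le> M) \<or> (\<exists>M. \<forall>x\<in>S. M \<le> u x)))"

text \<open>A bound above on a nonnull set becomes a two-sided bound on a nonnull symmetric part of it,
  and then, through differences, a two-sided bound near \<open>0\<close>. Since \<open>x \<mapsto> a x - x * a 1\<close>
  vanishes on the rationals, which are dense, it is bounded on the whole line; an additive
  bounded function is zero.\<close>

lemma additive_bounded_above_imp_linear:
  fixes a :: "real \<Rightarrow> real"
  assumes add: "\<And>x y. a (x + y) = a x + a y"
    and S: "S \<in> sets lebesgue" "emeasure lebesgue S > 0" "\<And>x. x \<in> S \<Longrightarrow> a x \<le> M"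
  shows "a x = x * a 1"
proof -
  have a0: "a 0 = 0" using add[of 0 0] by simp
  have aneg: "a (- x) = - a x" for x using add[of x "- x"] a0 by simp
  have adiff: "a (x - y) = a x - a y" for x y using add[of x "- y"] aneg by simp
  have anat: "a (real n * x) = real n * a x" for n x
  proof (induction n)
    case (Suc n)
    then show ?case using add[of x "real n * x"] by (simp add: algebra_simps)
  qed (simp add: a0)
  have aint: "a (of_int k * x) = of_int k * a x" for k x
  proof (cases k rule: int_cases2)
    case (nonneg n)
    then show ?thesis using anat[of n x] by simp
  next
    case (nonpos n)
    then show ?thesis using anat[of n x] aneg[of "real n * x"] by simp
  qed
  have arat: "a q = q * a 1" if Q: "q \<in> \<rat>" for q
  proof -
    obtain k :: int and n :: nat where q: "n \<noteq> 0" "q = of_int k / real n"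
      using Q unfolding Rats_eq_int_div_nat by blast
    have "real n * q = of_int k * 1" using q by simp
    then have "real n * a q = of_int k * a 1" using anat[of n q] aint[of k 1] by simp
    then have "a q = (of_int k * a 1) / real n"
      by (intro eq_divide_imp) (use q(1) in \<open>simp_all only: mult.commute of_nat_eq_0_iff, simp\<close>)
    then show ?thesis unfolding q(2) by simp
  qed
  obtain K where K: "compact K" "K \<subseteq> S" "emeasure lebesgue K > 0"
    using nonnull_imp_nonnull_compact S(1,2) .
  obtain p where p: "emeasure lebesgue (K \<inter> (\<lambda>x. p - x) ` K) > 0"
    using nonnull_imp_symmetric_nonnull K(1,3) .
  define T where "T = K \<inter> (\<lambda>x. p - x) ` K"
  have T: "compact T" "emeasure lebesgue T > 0"
    using K(1) p unfolding T_def
    by (auto intro!: compact_Int compact_continuous_image continuous_intros)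
  have aT: "a p - M \<le> a t \<and> a t \<le> M" if "t \<in> T" for t
    using that S(3)[of t] S(3)[of "p - t"] K(2) adiff[of p t] by (auto simp: T_def)
  obtain e where e: "e > 0" "\<And>t. \<bar>t\<bar> < e \<Longrightarrow> \<exists>s\<in>T. t + s \<in> T"
    using compact_nonnull_differences[OF T] by blast
  define b where "b x = a x - x * a 1" for x
  \<comment> \<open>\<open>2 * M - a p\<close> bounds \<open>a\<close> near \<open>0\<close>: it is the length of \<open>[a p - M, M]\<close>;
    the second summand bounds \<open>t * a 1\<close> for \<open>|t| < e\<close>\<close>
  define C where "C = (2 * M - a p) + e * \<bar>a 1\<bar>"
  have bC: "\<bar>b x\<bar> \<le> C" for x
  proof -
    obtain q where q: "q \<in> \<rat>" "x - e < q" "q < x" using Rats_dense_in_real[of "x - e" x] e(1) by auto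
    then have t: "\<bar>x - q\<bar> < e" by simp
    then obtain s where s: "s \<in> T" "(x - q) + s \<in> T" using e(2) by blast
    have "\<bar>a (x - q)\<bar> \<le> 2 * M - a p"
      using aT[OF s(1)] aT[OF s(2)] add[of "x - q" s] by linarith
    moreover have "\<bar>(x - q) * a 1\<bar> \<le> e * \<bar>a 1\<bar>"
      unfolding abs_mult using t by (intro mult_right_mono) auto
    moreover have "b x = a (x - q) - (x - q) * a 1"
      using adiff[of x q] arat[OF q(1)] by (simp add: b_def algebra_simps)
    ultimately show ?thesis unfolding C_def by linarith
  qed
  have "b x = 0"
  proof (rule ccontr)
    assume "b x \<noteq> 0"
    then obtain n :: nat where "C < real n * \<bar>b x\<bar>" using reals_Archimedean3[of "\<bar>b x\<bar>"] by auto
    moreover have "b (real n * x) = real n * b x" by (simp add: b_def anat right_diff_distrib)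
    ultimately show False using bC[of "real n * x"] by (simp add: abs_mult)
  qed
  then show ?thesis by (simp add: b_def)
qed

lemma additive_one_sided_bounded_imp_linear:
  fixes a u :: "real \<Rightarrow> real"
  assumes add: "\<And>x y. a (x + y) = a x + a y"
    and u: "one_sided_bounded_on_nonnull D u" "\<And>x. x \<in> D \<Longrightarrow> u x = a x"
  shows "a x = x * a 1"
proof -
  obtain S where S: "S \<in> sets lebesgue" "S \<subseteq> D" "emeasure lebesgue S > 0"
    and "(\<exists>M. \<forall>x\<in>S. u x \<le> M) \<or> (\<exists>M. \<forall>x\<in>S. M \<le> u x)"
    using u(1) by (auto simp: one_sided_bounded_on_nonnull_def)
  then consider M where "\<forall>x\<in>S. a x \<le> M" | M where "\<forall>x\<in>S. M \<le> a x"
    using u(2) by (metis subsetD)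
  then show ?thesis
  proof cases
    case 1
    then show ?thesis using additive_bounded_above_imp_linear[of a, OF add] S by blast
  next
    case (2 M)
    have "- a x = x * - a 1"
      by (rule additive_bounded_above_imp_linear[of "\<lambda>x. - a x" S "- M"]) (use 2 S add in auto)
    then show ?thesis by simp
  qed
qed

text \<open>Continuity at a point bounds \<open>u\<close> on a nearby interval, monotonicity on \<open>{c..d}\<close>, and a
  measurable \<open>u\<close> is bounded above on some nonnull \<open>{x \<in> D. u x \<le> n}\<close>, because these sets
  exhaust \<open>D\<close>.\<close>

lemma weakly_regular_imp_one_sided_bounded:
  assumes D: "is_interval D" "c \<in> D" "d \<in> D" "c < d" and u: "weakly_regular_on D u"
  shows "one_sided_bounded_on_nonnull D u"
proof -
  have cd: "{c..d} \<subseteq> D" using mem_is_interval_1_I[OF D(1-3)] by auto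
  have Dl: "D \<in> sets lebesgue"
    using real_interval_borel_measurable[OF D(1)] by simp
  have icd: "{c..d} \<in> sets lebesgue" "emeasure lebesgue {c..d} > 0" using D(4) by auto
  have u': "(\<exists>x\<in>D. continuous (at x within D) u) \<or> (mono_on D u \<or> antimono_on D u) \<or>
      u \<in> borel_measurable (lebesgue_on D) \<or> one_sided_bounded_on_nonnull D u"
    using u by (simp only: weakly_regular_on_def one_sided_bounded_on_nonnull_def)
  consider x where "x \<in> D" "continuous (at x within D) u" | "mono_on D u \<or> antimono_on D u"
    | "u \<in> borel_measurable (lebesgue_on D)" | "one_sided_bounded_on_nonnull D u"
    using u' by blast
  then show ?thesis
  proof cases
    case (1 x)
    then obtain e where e: "e > 0" "\<And>y. y \<in> D \<Longrightarrow> dist y x < e \<Longrightarrow> dist (u y) (u x) < 1"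
      unfolding continuous_within_eps_delta by (metis zero_less_one)
    obtain l r where lr: "l < r" "{l..r} \<subseteq> D" "{l..r} \<subseteq> ball x e"
    proof (cases "x < d")
      case True
      show ?thesis
      proof (rule that[of x "min d (x + e / 2)"])
        show "x < min d (x + e / 2)" using True e(1) by simp
        show "{x..min d (x + e / 2)} \<subseteq> D"
          using mem_is_interval_1_I[OF D(1) 1(1) D(3)] by auto
      qed (use e(1) in \<open>auto simp: dist_real_def\<close>)
    next
      case False
      show ?thesis
      proof (rule that[of "max c (x - e / 2)" x])
        show "max c (x - e / 2) < x" using False D(4) e(1) by simp
        show "{max c (x - e / 2)..x} \<subseteq> D"
          using mem_is_interval_1_I[OF D(1) D(2) 1(1)] by auto
      qed (use e(1) in \<open>auto simp: dist_real_def\<close>)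
    qed
    have "\<forall>y\<in>{l..r}. u y \<le> u x + 1"
      using e(2) lr by (fastforce simp: dist_real_def abs_if split: if_splits)
    then show ?thesis unfolding one_sided_bounded_on_nonnull_def
      using lr by (intro bexI[of _ "{l..r}"]) auto
  next
    case 2
    then have "(\<forall>x\<in>{c..d}. u x \<le> u d) \<or> (\<forall>x\<in>{c..d}. u d \<le> u x)"
    proof
      assume "mono_on D u"
      then have "u x \<le> u d" if "x \<in> {c..d}" for x
        using monotone_onD[of D "(\<le>)" "(\<le>)" u x d] cd D(3) that by auto
      then show ?thesis by blast
    next
      assume "antimono_on D u"
      then have "u d \<le> u x" if "x \<in> {c..d}" for x
        using monotone_onD[of D "(\<le>)" "(\<ge>)" u x d] cd D(3) that by auto
      then show ?thesis by blast
    qed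
    then show ?thesis unfolding one_sided_bounded_on_nonnull_def
      using icd cd by (intro bexI[of _ "{c..d}"]) blast+
  next
    case 3
    let ?A = "\<lambda>n::nat. {x \<in> D. u x \<le> real n}"
    have A: "?A n \<in> sets lebesgue" for n
    proof -
      have "{x \<in> space (lebesgue_on D). u x \<le> real n} \<in> sets (lebesgue_on D)"
        using 3 by measurable
      then show ?thesis using Dl by (simp add: sets_restrict_space_iff)
    qed
    have "\<exists>n. emeasure lebesgue (?A n) > 0"
    proof (rule ccontr)
      assume "\<nexists>n. emeasure lebesgue (?A n) > 0"
      then have "emeasure lebesgue (?A n) = 0" for n by (simp add: not_gr_zero)
      then have "emeasure lebesgue (\<Union>n. ?A n) = 0" using A by (intro emeasure_UN_eq_0) auto
      moreover have "(\<Union>n. ?A n) = D" using real_arch_simple by auto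
      moreover have "emeasure lebesgue {c..d} \<le> emeasure lebesgue D"
        using cd Dl by (intro emeasure_mono) auto
      ultimately show False using icd(2) by simp
    qed
    then obtain n where "emeasure lebesgue (?A n) > 0" ..
    then show ?thesis unfolding one_sided_bounded_on_nonnull_def
      using A by (intro bexI[of _ "?A n"] conjI disjI1) auto
  qed
qed

text \<open>Cauchy's equation on an interval such as \<open>[0,1]\<close> is reduced to Cauchy's equation on the line:
  the value at \<open>x\<close> of the extension is forced by the integer and the fractional part of \<open>x\<close>.\<close>

lemma additive_on_interval_extends:
  fixes u :: "real \<Rightarrow> real"
  assumes J: "is_interval J" "{0..1} \<subseteq> J" "J \<subseteq> {0..}"
    and add: "\<And>x y. x \<in> J \<Longrightarrow> y \<in> J \<Longrightarrow> x + y \<in> J \<Longrightarrow> u (x + y) = u x + u y"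
  obtains a where "\<And>x y. a (x + y) = a x + a y" "\<And>x. x \<in> J \<Longrightarrow> u x = a x"
proof
  define a where "a x = of_int \<lfloor>x\<rfloor> * u 1 + u (frac x)" for x :: real
  have J01: "x \<in> J" if "0 \<le> x" "x \<le> 1" for x using that J(2) by auto
  have Jdown: "x \<in> J" if "0 \<le> x" "x \<le> y" "y \<in> J" for x y
    using mem_is_interval_1_I[OF J(1) J01[of 0] that(3)] that(1,2) by simp
  have fr: "frac x \<in> J" "0 \<le> frac x" "frac x < 1" "frac x \<le> 1" for x :: real
    using frac_lt_1[of x] J01[of "frac x"] by auto
  show "a (x + y) = a x + a y" for x y
  proof (cases "frac x + frac y < 1")
    case True
    then have "u (frac x + frac y) = u (frac x) + u (frac y)"
      using fr by (intro add J01) auto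
    then show ?thesis using True by (simp add: a_def floor_add frac_add algebra_simps)
  next
    case False
    have 1: "u (frac x + frac y - 1 + (1 - frac y)) = u (frac x + frac y - 1) + u (1 - frac y)"
      using False fr[of x] fr[of y] by (intro add J01) auto
    have 2: "u (1 - frac y + frac y) = u (1 - frac y) + u (frac y)"
      using fr[of y] by (intro add J01) auto
    \<comment> \<open>the carry: both parts of \<open>frac x = (1 - frac y) + (frac x + frac y - 1)\<close> lie in \<open>[0,1]\<close>\<close>
    from 1 2 have "u (frac x + frac y - 1) + u 1 = u (frac x) + u (frac y)" by simp
    then show ?thesis using False by (simp add: a_def floor_add frac_add algebra_simps)
  qed
  have un: "u (real n) = real n * u 1" if "real n \<in> J" for n
    using that
  proof (induction n)
    case 0
    show ?case using add[of 0 0] J01[of 0] by simp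
  next
    case (Suc n)
    have "real n \<in> J" using Jdown[of "real n" "real (Suc n)"] Suc.prems by simp
    then show ?case using add[of "real n" 1] Suc J01[of 1] by (simp add: algebra_simps)
  qed
  show "u x = a x" if "x \<in> J" for x
  proof -
    have "0 \<le> x" using that J(3) by auto
    then have n: "of_int \<lfloor>x\<rfloor> = real (nat \<lfloor>x\<rfloor>)" by simp
    have f: "of_int \<lfloor>x\<rfloor> \<in> J" using Jdown[OF _ _ that] \<open>0 \<le> x\<close> by simp
    have "u (of_int \<lfloor>x\<rfloor> + frac x) = u (of_int \<lfloor>x\<rfloor>) + u (frac x)"
      using f fr that by (intro add) (auto simp: frac_def)
    then show ?thesis using un[of "nat \<lfloor>x\<rfloor>"] f n by (simp add: a_def frac_def)
  qed
qed
section \<open>Lovasz extensions as conewise linear functions\<close>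

text \<open>Up to the constant \<open>f 0\<close>, this is what being a Lovasz extension amounts to when \<open>I\<close> contains
  \<open>[0,1]\<close>: the linear maps on different cones then agree at common points by themselves.\<close>

definition conewise_linear_on ::
  "real set \<Rightarrow> (real ^ 'n::{finite,linorder} \<Rightarrow> real) \<Rightarrow> bool" where
  "conewise_linear_on I g \<longleftrightarrow>
     (\<forall>\<sigma>. \<sigma> permutes UNIV \<longrightarrow>
        (\<exists>L. linear L \<and> (\<forall>x \<in> cart_power I \<inter> order_cone \<sigma>. g x = L x)))"

text \<open>Separate finite sets of positions and of elements, in place of \<open>UNIV\<close>, make the induction
  possible: the largest position receives an element with the largest key, and both are removed.\<close>

lemma ex_bij_betw_sorting_key:
  fixes A :: "'a::linorder set" and k :: "'b \<Rightarrow> real"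
  assumes "finite A" "finite B" "card A = card B"
  shows "\<exists>s. bij_betw s A B \<and> (\<forall>i\<in>A. \<forall>j\<in>A. i \<le> j \<longrightarrow> k (s i) \<le> k (s j))"
  using assms
proof (induction A arbitrary: B rule: finite_linorder_max_induct)
  case empty
  then show ?case by (auto simp: bij_betw_def)
next
  case (insert b A)
  have bA: "b \<notin> A" using insert.hyps by auto
  have "B \<noteq> {}" using insert.prems bA insert.hyps(1) by auto
  then obtain m where m: "m \<in> B" "\<And>y. y \<in> B \<Longrightarrow> k y \<le> k m"
    using insert.prems(1) \<open>B \<noteq> {}\<close> obtains_MAX[of B k] by (metis Max_ge finite_imageI imageI)
  have "card A = card (B - {m})"
    using insert.prems insert.hyps(1) bA m(1) by simp
  then obtain s where s: "bij_betw s A (B - {m})" "\<forall>i\<in>A. \<forall>j\<in>A. i \<le> j \<longrightarrow> k (s i) \<le> k (s j)"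
    using insert.IH[of "B - {m}"] insert.prems(1) by auto
  have "bij_betw (s(b := m)) (insert b A) (insert m (B - {m}))"
    using s(1) bA unfolding bij_betw_def by (auto simp: inj_on_def)
  moreover have "insert m (B - {m}) = B" using m(1) by auto
  moreover have "k ((s(b := m)) i) \<le> k ((s(b := m)) j)"
    if "i \<in> insert b A" "j \<in> insert b A" "i \<le> j" for i j
  proof (cases "j = b")
    case True
    have "(s(b := m)) i \<in> B" using that(1) m(1) s(1) by (auto simp: bij_betw_def)
    then show ?thesis using True m(2) by simp
  next
    case False
    then have "j \<in> A" "i \<in> A" "i \<noteq> b" using that insert.hyps by auto
    then show ?thesis using s(2) that False by simp
  qed
  ultimately show ?case by metis
qed

lemma ex_order_cone:
  fixes x :: "real ^ 'n::{finite,linorder}"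
  obtains \<sigma> where "\<sigma> permutes UNIV" "x \<in> order_cone \<sigma>"
proof -
  obtain s :: "'n \<Rightarrow> 'n" where "bij s" "\<forall>i j. i \<le> j \<longrightarrow> x $ s i \<le> x $ s j"
    using ex_bij_betw_sorting_key[of "UNIV :: 'n set" "UNIV :: 'n set" "\<lambda>i. x $ i"] by auto
  then show ?thesis using that[of s] by (auto simp: order_cone_def intro: bij_imp_permutes)
qed

lemma order_cone_closed:
  assumes "x \<in> order_cone \<sigma>"
  shows "y \<in> order_cone \<sigma> \<Longrightarrow> x + y \<in> order_cone \<sigma>"
    and "0 \<le> t \<Longrightarrow> t *\<^sub>R x \<in> order_cone \<sigma>"
    and "min_const x c \<in> order_cone \<sigma>"
    and "x - min_const x c \<in> order_cone \<sigma>"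
proof -
  have x: "x $ \<sigma> i \<le> x $ \<sigma> j" if "i \<le> j" for i j
    using assms that by (simp add: order_cone_def)
  show "x + y \<in> order_cone \<sigma>" if "y \<in> order_cone \<sigma>"
    using x that by (simp add: order_cone_def add_mono)
  show "t *\<^sub>R x \<in> order_cone \<sigma>" if "0 \<le> t"
    using x that by (simp add: order_cone_def mult_left_mono)
  show "min_const x c \<in> order_cone \<sigma>"
    using x by (simp add: order_cone_def min_const_def min.coboundedI1)
  have "x $ \<sigma> i - min (x $ \<sigma> i) c \<le> x $ \<sigma> j - min (x $ \<sigma> j) c" if "i \<le> j" for i j
    using x[OF that] by (auto simp: min_def)
  then show "x - min_const x c \<in> order_cone \<sigma>"
    by (simp add: order_cone_def min_const_def)
qed

lemma scaled_ones_in_order_cone: "t *\<^sub>R indicator_vec UNIV \<in> order_cone \<sigma>"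
  by (simp add: order_cone_def indicator_vec_def)

lemma zero_in_order_cone: "0 \<in> order_cone \<sigma>"
  by (simp add: order_cone_def)

lemma indicator_vec_cart_power:
  "0 \<in> I \<Longrightarrow> t \<in> I \<Longrightarrow> t *\<^sub>R indicator_vec A \<in> cart_power I"
  by (simp add: cart_power_def indicator_vec_def)

text \<open>Any point of two cones can be moved into the unit cube by adding a multiple of the all-ones
  vector, which lies in every cone, and rescaling. In the cube both linear maps coincide with
  \<open>g\<close>, at the moved point and at the all-ones vector, hence they coincide at the original
  point.\<close>

lemma linear_agree_on_cones:
  fixes g :: "real ^ 'n::{finite,linorder} \<Rightarrow> real"
  assumes I: "{0..1} \<subseteq> I"
    and L: "linear L" "\<And>x. x \<in> cart_power I \<inter> order_cone \<sigma> \<Longrightarrow> g x = L x"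
    and M: "linear M" "\<And>x. x \<in> cart_power I \<inter> order_cone \<tau> \<Longrightarrow> g x = M x"
    and x: "x \<in> order_cone \<sigma>" "x \<in> order_cone \<tau>"
  shows "L x = M x"
proof -
  let ?one = "indicator_vec UNIV :: (real, 'n) vec"
  define b where "b = norm x + 1"
  have b: "b > 0" by (simp add: b_def add_nonneg_pos)
  have xb: "\<bar>x $ i\<bar> \<le> b" for i
    using component_le_norm_cart[of x i] by (simp add: b_def)
  define y where "y = (1 / (2 * b)) *\<^sub>R (x + b *\<^sub>R ?one)"
  have "y $ i \<in> {0..1}" for i
  proof -
    have "y $ i = (x $ i + b) / (2 * b)" by (simp add: y_def indicator_vec_def)
    moreover have "0 \<le> x $ i + b" "x $ i + b \<le> 2 * b" using xb[of i] by (auto simp: abs_le_iff)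
    ultimately show ?thesis using b by (simp add: divide_le_eq)
  qed
  then have "y \<in> cart_power I" using I by (auto simp: cart_power_def)
  moreover have "y \<in> order_cone \<sigma>" "y \<in> order_cone \<tau>"
    unfolding y_def using b x by (auto intro!: order_cone_closed scaled_ones_in_order_cone)
  ultimately have y: "L y = M y" using L(2)[of y] M(2)[of y] by simp
  have "0 \<in> I" "1 \<in> I" using I by auto
  then have "1 *\<^sub>R ?one \<in> cart_power I" by (rule indicator_vec_cart_power)
  moreover have "1 *\<^sub>R ?one \<in> order_cone \<rho>" for \<rho> by (rule scaled_ones_in_order_cone)
  ultimately have one: "L ?one = M ?one" using L(2)[of ?one] M(2)[of ?one] by simp
  have "L y = 1 / (2 * b) * (L x + b * L ?one)" "M y = 1 / (2 * b) * (M x + b * M ?one)"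
    unfolding y_def by (simp_all only: linear_add[OF L(1)] linear_scale[OF L(1)]
      linear_add[OF M(1)] linear_scale[OF M(1)] real_scaleR_def)
  then show ?thesis using y one b by simp
qed

text \<open>Given linear pieces for \<open>f - f 0\<close>, a global extension is obtained by evaluating at each point
  the piece of any cone containing it; the choice is immaterial by
  \<open>linear_agree_on_cones\<close>. The vertices of each simplex lie in the cone, so the extension
  serves as its own vertex data.\<close>

lemma lovasz_extension_on_iff_conewise_linear:
  fixes f :: "real ^ 'n::{finite,linorder} \<Rightarrow> real"
  assumes I: "{0..1} \<subseteq> I"
  shows "lovasz_extension_on I f \<longleftrightarrow> conewise_linear_on I (\<lambda>x. f x - f 0)"
proof
  assume "lovasz_extension_on I f"
  then obtain \<phi> F where F: "lovasz_extension_of \<phi> F" "\<And>x. x \<in> cart_power I \<Longrightarrow> f x = F x"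
    by (auto simp: lovasz_extension_on_def)
  have "0 \<in> I" using I by auto
  then have 0: "0 \<in> cart_power I" by (simp add: cart_power_def)
  show "conewise_linear_on I (\<lambda>x. f x - f 0)"
    unfolding conewise_linear_on_def
  proof (intro allI impI)
    fix \<sigma> :: "'n \<Rightarrow> 'n" assume "\<sigma> permutes UNIV"
    then obtain h b where h: "linear h" "\<And>x. x \<in> order_cone \<sigma> \<Longrightarrow> F x = h x + b"
      using F(1) unfolding lovasz_extension_of_def affine_fun_def by metis
    have "\<forall>x \<in> cart_power I \<inter> order_cone \<sigma>. f x - f 0 = h x"
      using F(2) 0 h(2) zero_in_order_cone linear_0[OF h(1)] by fastforce
    then show "\<exists>L. linear L \<and> (\<forall>x \<in> cart_power I \<inter> order_cone \<sigma>. f x - f 0 = L x)"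
      using h(1) by blast
  qed
next
  assume "conewise_linear_on I (\<lambda>x. f x - f 0)"
  then obtain L where L: "\<And>\<sigma>. \<sigma> permutes UNIV \<Longrightarrow> linear (L \<sigma>)"
    "\<And>\<sigma> x. \<sigma> permutes UNIV \<Longrightarrow> x \<in> cart_power I \<inter> order_cone \<sigma> \<Longrightarrow> f x - f 0 = L \<sigma> x"
    unfolding conewise_linear_on_def by metis
  obtain s where s: "\<And>x :: (real, 'n) vec. s x permutes UNIV" "\<And>x. x \<in> order_cone (s x)"
    using ex_order_cone by metis
  define F where "F x = L (s x) x + f 0" for x
  have FL: "F x = L \<sigma> x + f 0" if "\<sigma> permutes UNIV" "x \<in> order_cone \<sigma>" for \<sigma> x
    using linear_agree_on_cones[OF I L(1)[OF s(1)] L(2)[OF s(1)] L(1)[OF that(1)] L(2)[OF that(1)]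
      s(2)[of x] that(2)] by (simp add: F_def)
  have "lovasz_extension_of F F"
    unfolding lovasz_extension_of_def
  proof (intro allI impI)
    fix \<sigma> :: "'n \<Rightarrow> 'n" assume \<sigma>: "\<sigma> permutes UNIV"
    have "affine_fun (\<lambda>x. L \<sigma> x + f 0)" using L(1)[OF \<sigma>] by (auto simp: affine_fun_def)
    then show "\<exists>g. affine_fun g \<and>
        (\<forall>v. v extreme_point_of (cart_power {0..1} \<inter> order_cone \<sigma>) \<longrightarrow> g v = F v) \<and>
        (\<forall>x\<in>order_cone \<sigma>. F x = g x)"
      using FL[OF \<sigma>] by (intro exI[of _ "\<lambda>x. L \<sigma> x + f 0"]) (auto simp: extreme_point_of_def)
  qed
  moreover have "f x = F x" if "x \<in> cart_power I" for x
    using L(2)[OF s(1)[of x], of x] s(2)[of x] that by (simp add: F_def)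
  ultimately show "lovasz_extension_on I f" by (auto simp: lovasz_extension_on_def)
qed

section \<open>Horizontal min-additivity and linear diagonal sections give conewise linearity\<close>

text \<open>This makes the Choquet-type formula below linear by inspection, without naming the predecessor
  of an index: \<open>{j<..}\<close> is either empty or the upper interval of the successor of \<open>j\<close>.\<close>

lemma sum_upper_intervals_telescope:
  fixes w :: "'n::{finite,linorder} set \<Rightarrow> real"
  assumes "w {} = 0"
  shows "(\<Sum>j\<in>{i..}. w {j..} - w {j<..}) = w {i..}"
proof (induction "card {i..}" arbitrary: i rule: less_induct)
  case less
  have i: "{i..} = insert i {i<..}" by auto
  show ?case
  proof (cases "{i<..} = {}")
    case True
    then show ?thesis using assms i by simp
  next
    case False
    define k where "k = Min {i<..}"
    have "k \<in> {i<..}" unfolding k_def using False by (intro Min_in) auto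
    then have ik: "i < k" by simp
    have k: "{i<..} = {k..}"
    proof
      show "{i<..} \<subseteq> {k..}" unfolding k_def by auto
      show "{k..} \<subseteq> {i<..}" using ik by auto
    qed
    have "{k..} \<subset> {i..}" using ik by auto
    then have "card {k..} < card {i..}" by (rule psubset_card_mono[OF finite])
    then have "(\<Sum>j\<in>{k..}. w {j..} - w {j<..}) = w {k..}" by (rule less)
    moreover have "{i..} - {i} = {i<..}" by auto
    then have "(\<Sum>j\<in>{i..}. w {j..} - w {j<..}) = w {i..} - w {i<..} + (\<Sum>j\<in>{i<..}. w {j..} - w {j<..})"
      using sum.remove[of "{i..}" i "\<lambda>j. w {j..} - w {j<..}"] by simp
    ultimately show ?thesis by (simp add: k)
  qed
qed

text \<open>On the cone of \<open>\<sigma>\<close> the candidate is the only linear map taking the value \<open>g (indicator_vec A)\<close> at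
  each \<open>A = \<sigma> ` {i..}\<close>. A nonnegative \<open>x\<close> in the cone is peeled from below: cutting at its
  smallest positive coordinate splits off a multiple of the indicator of its support, which is
  such a set \<open>A\<close>, and leaves a point of the cone with smaller support. A general \<open>x\<close> is first
  cut at a lower bound \<open>c \<le> 0\<close> of its coordinates; the constant vector \<open>c\<close> is handled by cutting
  \<open>0\<close> at \<open>c\<close>.\<close>

lemma horizontally_min_additive_imp_conewise_linear:
  fixes g :: "real ^ 'n::{finite,linorder} \<Rightarrow> real"
  assumes I: "is_interval I" "{0..1} \<subseteq> I" "I \<subseteq> {0..} \<or> I = UNIV"
    and g: "horizontally_min_additive I g"
    and lin: "\<And>A t. t \<in> I \<Longrightarrow> 0 \<le> t \<Longrightarrow> delta g A t = t * delta g A 1"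
  shows "conewise_linear_on I g"
  unfolding conewise_linear_on_def
proof (intro allI impI)
  fix \<sigma> :: "'n \<Rightarrow> 'n" assume \<sigma>: "\<sigma> permutes UNIV"
  have inj: "\<sigma> i = \<sigma> j \<longleftrightarrow> i = j" for i j using permutes_inj[OF \<sigma>] by (simp add: inj_eq)
  have surj: "\<exists>i. j = \<sigma> i" for j using permutes_surj[OF \<sigma>] by (metis surjD)
  have I0: "0 \<in> I" "1 \<in> I" using I(2) by auto
  have Idown: "s \<in> I" if "0 \<le> s" "s \<le> t" "t \<in> I" for s t
    using mem_is_interval_1_I[OF I(1) I0(1) that(3)] that(1,2) by simp
  have g0: "g 0 = 0" using lin[of 0 UNIV] I0 by (simp add: delta_def)
  define v where "v A = g (indicator_vec A)" for A
  have v0: "v {} = 0"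
  proof -
    have "indicator_vec {} = (0 :: (real, 'n) vec)" by (simp add: indicator_vec_def vec_eq_iff)
    then show ?thesis by (simp add: v_def g0)
  qed
  have gv: "g (t *\<^sub>R indicator_vec A) = t * v A" if "t \<in> I" "0 \<le> t" for t A
    using lin[OF that, of A] by (simp add: delta_def v_def)
  define L where "L x = (\<Sum>i\<in>UNIV. x $ \<sigma> i * (v (\<sigma> ` {i..}) - v (\<sigma> ` {i<..})))" for x :: "(real, 'n) vec"
  have L: "linear L"
    by (rule linearI) (simp_all add: L_def distrib_right sum.distrib sum_distrib_left mult.assoc)
  have Lv: "L (indicator_vec (\<sigma> ` {i..})) = v (\<sigma> ` {i..})" for i
  proof -
    have "L (indicator_vec (\<sigma> ` {i..})) = (\<Sum>j\<in>UNIV. if j \<in> {i..} then v (\<sigma> ` {j..}) - v (\<sigma> ` {j<..}) else 0)"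
      unfolding L_def by (intro sum.cong) (auto simp: indicator_vec_def inj)
    also have "\<dots> = (\<Sum>j\<in>{i..}. v (\<sigma> ` {j..}) - v (\<sigma> ` {j<..}))"
      by (intro sum.mono_neutral_cong_right) auto
    also have "\<dots> = v (\<sigma> ` {i..})"
      using sum_upper_intervals_telescope[of "\<lambda>A. v (\<sigma> ` A)" i] v0 by simp
    finally show ?thesis .
  qed
  have nonneg: "g x = L x" if "x \<in> cart_power I" "x \<in> order_cone \<sigma>" "\<And>j. 0 \<le> x $ j" for x
    using that
  proof (induction "card {j. 0 < x $ j}" arbitrary: x rule: less_induct)
    case less
    show ?case
    proof (cases "\<exists>i. 0 < x $ \<sigma> i")
      case False
      then have "x $ j = 0" for j using surj less.prems(3) by (metis order_less_le)
      then have "x = 0" by (simp add: vec_eq_iff)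
      then show ?thesis using g0 linear_0[OF L] by simp
    next
      case True
      define i where "i = Min {i. 0 < x $ \<sigma> i}"
      have i: "0 < x $ \<sigma> i"
        using True Min_in[of "{i. 0 < x $ \<sigma> i}"] unfolding i_def by auto
      define c where "c = x $ \<sigma> i"
      have above: "c \<le> x $ \<sigma> j" if "i \<le> j" for j
        using less.prems(2) that by (simp add: order_cone_def c_def)
      have below: "x $ \<sigma> j = 0" if "\<not> i \<le> j" for j
      proof -
        have "\<not> 0 < x $ \<sigma> j" using that Min_le[of "{i. 0 < x $ \<sigma> i}" j] unfolding i_def by auto
        then show ?thesis using less.prems(3)[of "\<sigma> j"] by simp
      qed
      have cI: "c \<in> I" "0 < c" using less.prems(1) i by (auto simp: cart_power_def c_def)
      have mc: "min_const x c = c *\<^sub>R indicator_vec (\<sigma> ` {i..})"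
      proof (subst vec_eq_iff, intro allI)
        fix j obtain k where k: "j = \<sigma> k" using surj by blast
        show "min_const x c $ j = (c *\<^sub>R indicator_vec (\<sigma> ` {i..})) $ j"
          using above[of k] below[of k] cI(2) by (auto simp: min_const_def indicator_vec_def k image_iff inj)
      qed
      let ?y = "x - min_const x c"
      have y: "0 \<le> ?y $ j" "?y $ j \<le> x $ j" for j
        using less.prems(3)[of j] cI(2) by (auto simp: min_const_def)
      have yI: "?y \<in> cart_power I"
        using y less.prems(1) unfolding cart_power_def by (blast intro: Idown)
      have "\<sigma> i \<in> {j. 0 < x $ j}" "\<sigma> i \<notin> {j. 0 < ?y $ j}"
        using i by (auto simp: min_const_def c_def)
      moreover have "{j. 0 < ?y $ j} \<subseteq> {j. 0 < x $ j}"
        using less_le_trans[OF _ y(2)] by blast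
      ultimately have "{j. 0 < ?y $ j} \<subset> {j. 0 < x $ j}" by blast
      then have "card {j. 0 < ?y $ j} < card {j. 0 < x $ j}"
        by (intro psubset_card_mono) auto
      then have gy: "g ?y = L ?y"
        using yI order_cone_closed(4)[OF less.prems(2)] y(1) by (rule less.hyps)
      have "g x = g (min_const x c) + g ?y"
        using g less.prems(1) cI(1) yI unfolding horizontally_min_additive_def by blast
      also have "g (min_const x c) = L (min_const x c)"
        unfolding mc using gv[OF cI(1)] cI(2) by (simp add: linear_scale[OF L] Lv)
      also have "L (min_const x c) + g ?y = L x"
        unfolding gy by (simp add: linear_add[OF L, symmetric])
      finally show ?thesis .
    qed
  qed
  have "g x = L x" if x: "x \<in> cart_power I \<inter> order_cone \<sigma>" for x
  proof (cases "I = UNIV")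
    case False
    then show ?thesis using nonneg[of x] x I(3) by (auto simp: cart_power_def)
  next
    case True
    let ?one = "indicator_vec UNIV :: (real, 'n) vec"
    have ones: "g (t *\<^sub>R ?one) = L (t *\<^sub>R ?one)" if "0 \<le> t" for t
      using that True by (intro nonneg scaled_ones_in_order_cone) (auto simp: cart_power_def indicator_vec_def)
    define c where "c = min 0 (Min (range (($) x)))"
    have c: "c \<le> 0" "c \<le> x $ j" for j
      using Min_le[of "range (($) x)" "x $ j"] by (auto simp: c_def min.coboundedI2)
    have mc: "min_const x c = c *\<^sub>R ?one"
      using c(2) by (simp add: vec_eq_iff min_const_def indicator_vec_def min_absorb2)
    have m0: "min_const 0 c = c *\<^sub>R ?one"
      using c(1) by (simp add: vec_eq_iff min_const_def indicator_vec_def)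
    have "g 0 = g (min_const 0 c) + g (0 - min_const 0 c)"
      using g True unfolding horizontally_min_additive_def cart_power_def by blast
    then have "g 0 = g (c *\<^sub>R ?one) + g ((- c) *\<^sub>R ?one)"
      unfolding m0 by simp
    then have "g (c *\<^sub>R ?one) = L (c *\<^sub>R ?one)"
      using g0 ones[of "- c"] c(1) by (simp add: linear_neg[OF L])
    moreover have "g (x - min_const x c) = L (x - min_const x c)"
      using x True c by (intro nonneg order_cone_closed) (auto simp: cart_power_def min_const_def)
    moreover have "g x = g (min_const x c) + g (x - min_const x c)"
      using g True unfolding horizontally_min_additive_def cart_power_def by blast
    ultimately show ?thesis unfolding mc by (simp add: linear_diff[OF L])
  qed
  then show "\<exists>L. linear L \<and> (\<forall>x \<in> cart_power I \<inter> order_cone \<sigma>. g x = L x)"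
    using L by blast
qed

text \<open>Cutting preserves the order of the coordinates, so the two parts are comonotonic.\<close>

lemma comonotonically_additive_imp_horizontally_min_additive:
  fixes g :: "real ^ 'n::{finite,linorder} \<Rightarrow> real"
  assumes "comonotonically_additive I g"
  shows "horizontally_min_additive I g"
  unfolding horizontally_min_additive_def
proof (intro ballI impI)
  fix x :: "(real, 'n) vec" and c assume x: "x \<in> cart_power I" and c: "c \<in> I" and d: "x - min_const x c \<in> cart_power I"
  obtain \<sigma> where \<sigma>: "\<sigma> permutes UNIV" "x \<in> order_cone \<sigma>" using ex_order_cone .
  have "comonotonic (min_const x c) (x - min_const x c)"
    unfolding comonotonic_def using \<sigma>(1) order_cone_closed(3,4)[OF \<sigma>(2)] by blast
  moreover have "min_const x c \<in> cart_power I"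
    using x c by (auto simp: cart_power_def min_const_def min_def)
  moreover have "min_const x c + (x - min_const x c) \<in> cart_power I" using x by simp
  ultimately have "g (min_const x c + (x - min_const x c)) = g (min_const x c) + g (x - min_const x c)"
    using assms d unfolding comonotonically_additive_def by blast
  then show "g x = g (min_const x c) + g (x - min_const x c)" by simp
qed

lemma conewise_linear_imp_comonotonically_additive:
  fixes g :: "real ^ 'n::{finite,linorder} \<Rightarrow> real"
  assumes "conewise_linear_on I g"
  shows "comonotonically_additive I g"
  unfolding comonotonically_additive_def
proof (intro ballI impI)
  fix x y :: "(real, 'n) vec" assume x: "x \<in> cart_power I" and y: "y \<in> cart_power I"
    and xy: "comonotonic x y \<and> x + y \<in> cart_power I"
  obtain \<sigma> where \<sigma>: "\<sigma> permutes UNIV" "x \<in> order_cone \<sigma>" "y \<in> order_cone \<sigma>"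
    using xy by (auto simp: comonotonic_def)
  obtain L where L: "linear L" "\<And>x. x \<in> cart_power I \<inter> order_cone \<sigma> \<Longrightarrow> g x = L x"
    using assms \<sigma>(1) unfolding conewise_linear_on_def by metis
  show "g (x + y) = g x + g y"
    using L(2)[of x] L(2)[of y] L(2)[of "x + y"] x y xy \<sigma> order_cone_closed(1)[OF \<sigma>(2,3)]
    by (simp add: linear_add[OF L(1)])
qed

section \<open>Regularity makes the diagonal sections linear\<close>

text \<open>Cutting \<open>(s + t)\<close> times an indicator at height \<open>s\<close> leaves \<open>t\<close> times the indicator.\<close>

lemma horizontally_min_additive_delta_add:
  assumes I: "0 \<in> I" and g: "horizontally_min_additive I g"
    and st: "0 \<le> s" "0 \<le> t" "s \<in> I" "t \<in> I" "s + t \<in> I"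
  shows "delta g A (s + t) = delta g A s + delta g A t"
proof -
  let ?x = "(s + t) *\<^sub>R indicator_vec A"
  have m: "min_const ?x s = s *\<^sub>R indicator_vec A"
    using st(1,2) by (auto simp: vec_eq_iff min_const_def indicator_vec_def)
  have d: "?x - min_const ?x s = t *\<^sub>R indicator_vec A" unfolding m by (simp add: algebra_simps)
  have "?x \<in> cart_power I" using I st(5) by (rule indicator_vec_cart_power)
  moreover have "?x - min_const ?x s \<in> cart_power I"
    unfolding d using I st(4) by (rule indicator_vec_cart_power)
  ultimately have "g ?x = g (min_const ?x s) + g (?x - min_const ?x s)"
    using g st(3) unfolding horizontally_min_additive_def by blast
  then show ?thesis unfolding d unfolding m delta_def .
qed

text \<open>Cutting \<open>r\<close> times the indicator of \<open>A\<close> at the height \<open>r \<le> 0\<close> itself lowers the coordinates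
  outside \<open>A\<close> to \<open>r\<close>. This exchanges information about the negative half-line for \<open>A\<close> with
  information about the positive half-line for its complement.\<close>

lemma horizontally_min_additive_delta_neg:
  assumes g: "horizontally_min_additive UNIV g" and r: "r \<le> 0"
  shows "delta g A r = delta g UNIV r + delta g (- A) (- r)"
proof -
  let ?x = "r *\<^sub>R indicator_vec A"
  have m: "min_const ?x r = r *\<^sub>R indicator_vec UNIV"
    using r by (auto simp: vec_eq_iff min_const_def indicator_vec_def)
  have d: "?x - min_const ?x r = (- r) *\<^sub>R indicator_vec (- A)"
    unfolding m by (auto simp: vec_eq_iff indicator_vec_def)
  have "g ?x = g (min_const ?x r) + g (?x - min_const ?x r)"
    using g unfolding horizontally_min_additive_def cart_power_def by blast
  then show ?thesis unfolding d unfolding m delta_def .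
qed

lemma delta_linear_of_nonneg_regular:
  assumes I: "is_interval I" "{0..1} \<subseteq> I"
    and g: "horizontally_min_additive I g"
    and bd: "one_sided_bounded_on_nonnull (I \<inter> {0..}) (delta g A)"
    and t: "t \<in> I" "0 \<le> t"
  shows "delta g A t = t * delta g A 1"
proof -
  have I0: "0 \<in> I" "1 \<in> I" using I by auto
  have J: "is_interval (I \<inter> {0..})" "{0..1} \<subseteq> I \<inter> {0..}" "I \<inter> {0..} \<subseteq> {0..}"
    using I(2) is_interval_Int[OF I(1) is_interval_ci[of 0]] by auto
  obtain a where a: "\<And>x y. a (x + y) = a x + a y" "\<And>x. x \<in> I \<inter> {0..} \<Longrightarrow> delta g A x = a x"
    using additive_on_interval_extends[OF J, of "delta g A"]
      horizontally_min_additive_delta_add[OF I0(1) g] by auto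
  have "a t = t * a 1" using additive_one_sided_bounded_imp_linear[OF a(1) bd a(2)] .
  then show ?thesis using a(2) t I0 by simp
qed

text \<open>The sections are additive on the nonnegative half-line, while the regularity is known on the
  other half. With additive extensions \<open>a\<close> and \<open>b\<close> of the nonnegative sections for \<open>A\<close> and for the
  full index set, the section for the complement of \<open>A\<close> equals the additive function
  \<open>b - a\<close> on the nonpositive half-line. Regularity of this section and of the full one makes
  \<open>b - a\<close> and \<open>b\<close> linear, hence also \<open>a\<close>.\<close>

lemma delta_linear_of_nonpos_regular:
  assumes g: "horizontally_min_additive UNIV g"
    and bd: "\<And>A. one_sided_bounded_on_nonnull {..0} (delta g A)"
    and t: "0 \<le> t"
  shows "delta g A t = t * delta g A 1"
proof -
  have ext: "\<exists>a. (\<forall>x y. a (x + y) = a x + a y) \<and> (\<forall>x\<ge>0. delta g A x = a x)" for A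
  proof -
    have add: "delta g A (x + y) = delta g A x + delta g A y" if "x \<in> {0..}" "y \<in> {0..}" for x y
      using horizontally_min_additive_delta_add[OF _ g] that by simp
    obtain a where "\<And>x y. a (x + y) = a x + a y" "\<And>x. x \<in> {0..} \<Longrightarrow> delta g A x = a x"
      using additive_on_interval_extends[of "{0..}" "delta g A", OF is_interval_ci _ _ add] by auto
    then show ?thesis by auto
  qed
  obtain a where a: "\<And>x y. a (x + y) = a x + a y" "\<And>x. 0 \<le> x \<Longrightarrow> delta g A x = a x"
    using ext by metis
  obtain b where b: "\<And>x y. b (x + y) = b x + b y" "\<And>x. 0 \<le> x \<Longrightarrow> delta g UNIV x = b x"
    using ext by metis
  have neg: "a (- x) = - a x" "b (- x) = - b x" for x
    using a(1)[of x "- x"] b(1)[of x "- x"] a(1)[of 0 0] b(1)[of 0 0] by simp_all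
  have g0: "delta g B 0 = 0" for B
    using horizontally_min_additive_delta_add[of UNIV g 0 0] g by simp
  have b': "delta g UNIV x = b x" if "x \<le> 0" for x
  proof -
    \<comment> \<open>\<open>A = {}\<close> shows that the full section is odd\<close>
    have "delta g {} x = delta g UNIV x + delta g UNIV (- x)"
      using horizontally_min_additive_delta_neg[OF g that, of "{}"] by simp
    moreover have "delta g {} x = delta g {} 0"
      unfolding delta_def by (rule arg_cong[of _ _ g]) (simp add: vec_eq_iff indicator_vec_def)
    ultimately show ?thesis using b(2)[of "- x"] that neg(2) g0 by simp
  qed
  have ba: "delta g (- A) x = b x - a x" if "x \<le> 0" for x
    using horizontally_min_additive_delta_neg[OF g that, of "- A"] b'[OF that] a(2)[of "- x"] that neg(1)
    by simp
  have "b t = t * b 1"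
    by (rule additive_one_sided_bounded_imp_linear[OF b(1) bd[of UNIV]]) (use b' in auto)
  moreover have "b t - a t = t * (b 1 - a 1)"
    by (rule additive_one_sided_bounded_imp_linear[OF _ bd[of "- A"]]) (use ba a(1) b(1) in auto)
  ultimately show ?thesis using a(2) t by (simp add: algebra_simps)
qed

section \<open>Reflection and horizontal max-additivity\<close>

lemma one_sided_bounded_on_nonnull_reflect:
  assumes "one_sided_bounded_on_nonnull D u"
  shows "one_sided_bounded_on_nonnull (uminus ` D) (\<lambda>x. u (- x))"
proof -
  obtain S where S: "S \<in> sets lebesgue" "S \<subseteq> D" "emeasure lebesgue S > 0"
    and u: "(\<exists>M. \<forall>x\<in>S. u x \<le> M) \<or> (\<exists>M. \<forall>x\<in>S. M \<le> u x)"
    using assms by (auto simp: one_sided_bounded_on_nonnull_def)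
  have "emeasure lebesgue (uminus ` S) = emeasure lebesgue S"
    using emeasure_lebesgue_affine[of "-1" 0 S] by simp
  moreover have "uminus ` S \<in> sets lebesgue"
  proof -
    have "(*\<^sub>R) (- 1) -` S \<inter> space lebesgue \<in> sets lebesgue"
      using lebesgue_measurable_scaling S(1) by (rule measurable_sets)
    moreover have "(*\<^sub>R) (- 1) -` S \<inter> space lebesgue = uminus ` S"
      by (auto simp: image_iff) (metis minus_minus)
    ultimately show ?thesis by simp
  qed
  ultimately show ?thesis
    unfolding one_sided_bounded_on_nonnull_def using S u by (intro bexI[of _ "uminus ` S"]) auto
qed

text \<open>A point with strictly increasing coordinates along \<open>\<sigma>\<close> determines the order, so a cone that
  contains its negative contains the negative of the whole cone of \<open>\<sigma>\<close>.\<close>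

lemma conewise_linear_reflect:
  fixes g :: "real ^ 'n::{finite,linorder} \<Rightarrow> real"
  assumes "conewise_linear_on UNIV (\<lambda>x. g (- x))"
  shows "conewise_linear_on UNIV g"
  unfolding conewise_linear_on_def
proof (intro allI impI)
  fix \<sigma> :: "'n \<Rightarrow> 'n" assume \<sigma>: "\<sigma> permutes UNIV"
  \<comment> \<open>the coordinate at \<open>\<sigma> i\<close> is minus the rank of \<open>i\<close>, so \<open>z\<close> is the negative of a strictly
    increasing point\<close>
  define z :: "(real, 'n) vec" where "z = (\<chi> j. - real (card {..< inv \<sigma> j}))"
  have z: "z $ \<sigma> i = - real (card {..<i})" for i
    by (simp add: z_def inv_f_f[OF permutes_inj[OF \<sigma>]])
  obtain \<tau> where \<tau>: "\<tau> permutes UNIV" "z \<in> order_cone \<tau>" using ex_order_cone .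
  have cone: "- x \<in> order_cone \<tau>" if x: "x \<in> order_cone \<sigma>" for x
  proof -
    have "x $ \<tau> j \<le> x $ \<tau> i" if "i \<le> j" for i j
    proof -
      obtain k l where kl: "\<tau> i = \<sigma> k" "\<tau> j = \<sigma> l" using permutes_surj[OF \<sigma>] by (metis surjD)
      have "z $ \<tau> i \<le> z $ \<tau> j" using \<tau>(2) that by (simp add: order_cone_def)
      then have "card {..<l} \<le> card {..<k}" by (simp add: kl z)
      then have "l \<le> k" using psubset_card_mono[of "{..<l}" "{..<k}"]
        by (metis finite lessThan_strict_subset_iff linorder_not_less psubset_card_mono)
      then show ?thesis using x by (simp add: kl order_cone_def)
    qed
    then show ?thesis by (simp add: order_cone_def)
  qed
  obtain L where L: "linear L" "\<And>x. x \<in> order_cone \<tau> \<Longrightarrow> g (- x) = L x"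
    using assms \<tau>(1) by (auto simp: conewise_linear_on_def cart_power_def)
  have "linear (\<lambda>x. - L x)" using L(1) by (rule linear_compose_neg)
  moreover have "g x = - L x" if "x \<in> order_cone \<sigma>" for x
    using L(2)[OF cone[OF that]] by (simp add: linear_neg[OF L(1)])
  ultimately show "\<exists>L. linear L \<and> (\<forall>x \<in> cart_power UNIV \<inter> order_cone \<sigma>. g x = L x)" by blast
qed

lemma horizontally_max_additive_reflect:
  fixes g :: "real ^ 'n \<Rightarrow> real"
  assumes "horizontally_max_additive UNIV g"
  shows "horizontally_min_additive UNIV (\<lambda>x. g (- x))"
  unfolding horizontally_min_additive_def
proof (intro ballI impI)
  fix x :: "(real, 'n) vec" and c :: real
  have m: "max_const (- x) (- c) = - min_const x c"
    by (auto simp: vec_eq_iff max_const_def min_const_def min_def max_def)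
  have "g (- x) = g (max_const (- x) (- c)) + g (- x - max_const (- x) (- c))"
    using assms unfolding horizontally_max_additive_def cart_power_def by blast
  then show "g (- x) = g (- min_const x c) + g (- (x - min_const x c))"
    unfolding m by simp
qed

section \<open>The characterization\<close>

text \<open>Comonotonic additivity is a special case of horizontal min-additivity, and horizontal
  max-additivity becomes horizontal min-additivity under \<open>x \<mapsto> - x\<close>, which interchanges the two
  half-lines; hence both half-lines are treated simultaneously.\<close>

lemma regular_condition_i_imp_conewise_linear:
  fixes g :: "real ^ 'n::{finite,linorder} \<Rightarrow> real"
  assumes I: "is_interval I" "({0..1} \<subseteq> I \<and> I \<subseteq> {0..}) \<or> I = UNIV"
    and g: "condition_i I g"
    and J: "J = I \<inter> {0..} \<or> I = UNIV \<and> J = {..0}"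
    and reg: "\<And>A. weakly_regular_on J (delta g A)"
  shows "conewise_linear_on I g"
proof -
  have I01: "{0..1} \<subseteq> I" "I \<subseteq> {0..} \<or> I = UNIV" using I(2) by auto
  have bd: "one_sided_bounded_on_nonnull J (delta g A)" for A
    using J
  proof
    assume J: "J = I \<inter> {0..}"
    show ?thesis
      by (rule weakly_regular_imp_one_sided_bounded[of J 0 1])
        (use J I01 is_interval_Int[OF I(1) is_interval_ci[of 0]] reg in auto)
  next
    assume J: "I = UNIV \<and> J = {..0}"
    show ?thesis
      by (rule weakly_regular_imp_one_sided_bounded[of J "-1" 0])
        (use J reg is_interval_ic[of 0] in auto)
  qed
  show ?thesis
  proof (cases "horizontally_min_additive I g")
    case True
    have "delta g A t = t * delta g A 1" if "t \<in> I" "0 \<le> t" for A t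
      using J delta_linear_of_nonneg_regular[OF I(1) I01(1) True _ that]
        delta_linear_of_nonpos_regular[of g, OF _ _ that(2)] True bd by blast
    then show ?thesis
      using horizontally_min_additive_imp_conewise_linear[OF I(1) I01 True] by blast
  next
    case False
    then have U: "I = UNIV" "horizontally_max_additive UNIV g"
      using g comonotonically_additive_imp_horizontally_min_additive unfolding condition_i_def by auto
    define h where "h x = g (- x)" for x
    have h: "horizontally_min_additive UNIV h"
      unfolding h_def using U(2) by (rule horizontally_max_additive_reflect)
    have dh: "delta h A = (\<lambda>x. delta g A (- x))" for A
      by (simp add: delta_def h_def fun_eq_iff)
    have bh: "one_sided_bounded_on_nonnull (uminus ` J) (delta h A)" for A
      unfolding dh using bd by (rule one_sided_bounded_on_nonnull_reflect)
    have J': "uminus ` J = {..0} \<or> uminus ` J = UNIV \<inter> {0..}" using J U(1) by auto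
    have "delta h A t = t * delta h A 1" if "0 \<le> t" for A t
      using J'
    proof
      assume "uminus ` J = {..0}"
      then show ?thesis using delta_linear_of_nonpos_regular[OF h _ that] bh by simp
    next
      assume "uminus ` J = UNIV \<inter> {0..}"
      then have "one_sided_bounded_on_nonnull (UNIV \<inter> {0..}) (delta h A)" using bh[of A] by simp
      then show ?thesis
        using that by (intro delta_linear_of_nonneg_regular[OF is_interval_univ subset_UNIV h]) simp_all
    qed
    then have "conewise_linear_on UNIV h"
      using horizontally_min_additive_imp_conewise_linear[OF is_interval_univ subset_UNIV _ h] by blast
    then show ?thesis unfolding h_def U(1) by (rule conewise_linear_reflect)
  qed
qed

lemma weakly_regular_on_if_bounded:
  assumes "c < d" "{c..d} \<subseteq> D" "\<And>t. c \<le> t \<Longrightarrow> t \<le> d \<Longrightarrow> u t \<le> M"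
  shows "weakly_regular_on D u"
proof -
  have "\<exists>S\<in>sets lebesgue. S \<subseteq> D \<and> emeasure lebesgue S > 0 \<and> (\<exists>M. \<forall>x\<in>S. u x \<le> M)"
    using assms by (intro bexI[of _ "{c..d}"] conjI exI[of _ M]) auto
  then show ?thesis unfolding weakly_regular_on_def by blast
qed

text \<open>The ray through \<open>e\<close> times an indicator stays in one cone, so \<open>g\<close> is linear along it. The signs
  \<open>e = 1\<close> and \<open>e = - 1\<close> give the two half-lines.\<close>

lemma conewise_linear_delta_bounded:
  fixes g :: "real ^ 'n::{finite,linorder} \<Rightarrow> real"
  assumes g: "conewise_linear_on I g" and I: "0 \<in> I"
  shows "\<exists>M. \<forall>t. 0 \<le> t \<longrightarrow> t \<le> 1 \<longrightarrow> e * t \<in> I \<longrightarrow> delta g A (e * t) \<le> M"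
proof -
  obtain \<sigma> where \<sigma>: "\<sigma> permutes UNIV" "e *\<^sub>R indicator_vec A \<in> order_cone \<sigma>" using ex_order_cone .
  obtain L where L: "linear L" "\<And>x. x \<in> cart_power I \<inter> order_cone \<sigma> \<Longrightarrow> g x = L x"
    using g \<sigma>(1) unfolding conewise_linear_on_def by metis
  have "delta g A (e * t) \<le> \<bar>L (e *\<^sub>R indicator_vec A)\<bar>" if t: "0 \<le> t" "t \<le> 1" "e * t \<in> I" for t
  proof -
    have eq: "(e * t) *\<^sub>R indicator_vec A = t *\<^sub>R (e *\<^sub>R indicator_vec A)" by simp
    have "t *\<^sub>R (e *\<^sub>R indicator_vec A) \<in> cart_power I \<inter> order_cone \<sigma>"
      using indicator_vec_cart_power[OF I t(3), of A] order_cone_closed(2)[OF \<sigma>(2) t(1)] unfolding eq by blast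
    then have "delta g A (e * t) = t * L (e *\<^sub>R indicator_vec A)"
      unfolding delta_def eq using L(2) linear_scale[OF L(1)] by simp
    also have "\<dots> \<le> t * \<bar>L (e *\<^sub>R indicator_vec A)\<bar>"
      using t by (intro mult_left_mono) auto
    also have "\<dots> \<le> 1 * \<bar>L (e *\<^sub>R indicator_vec A)\<bar>"
      using t by (intro mult_right_mono) auto
    finally show ?thesis by simp
  qed
  then show ?thesis by blast
qed

lemma conewise_linear_imp_condition_ii:
  fixes g :: "real ^ 'n::{finite,linorder} \<Rightarrow> real"
  assumes g: "conewise_linear_on I g" and I: "{0..1} \<subseteq> I"
  shows "condition_ii I (I \<inter> {0..}) g"
    and "I = UNIV \<Longrightarrow> condition_ii I {..0} g"
proof -
  have I0: "0 \<in> I" using I by auto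
  have pos: "weakly_regular_on D (delta g A)" if "{0..1} \<subseteq> D" for D A
  proof -
    obtain M where M: "\<And>t. 0 \<le> t \<Longrightarrow> t \<le> 1 \<Longrightarrow> t \<in> I \<Longrightarrow> delta g A t \<le> M"
      using conewise_linear_delta_bounded[OF g I0, of 1 A] by auto
    show ?thesis
      by (rule weakly_regular_on_if_bounded[of 0 1 _ _ M]) (use that M I in auto)
  qed
  then show "condition_ii I (I \<inter> {0..}) g" using I by (auto simp: condition_ii_def)
  show "condition_ii I {..0} g" if U: "I = UNIV"
  proof -
    have "weakly_regular_on {..0} (delta g A)" for A
    proof -
      obtain M where M: "\<And>t. 0 \<le> t \<Longrightarrow> t \<le> 1 \<Longrightarrow> delta g A (- t) \<le> M"
        using conewise_linear_delta_bounded[OF g I0, of "-1" A] U by auto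
      show ?thesis
      proof (rule weakly_regular_on_if_bounded[of "-1" 0 _ _ M])
        show "delta g A t \<le> M" if "- 1 \<le> t" "t \<le> 0" for t
          using M[of "- t"] that by simp
      qed auto
    qed
    then show ?thesis using pos[OF I] by (auto simp: condition_ii_def)
  qed
qed

lemma pos_homogeneous_imp_condition_ii:
  assumes I: "{0..1} \<subseteq> I" and g: "g 0 = 0" and hom: "\<And>A. pos_homogeneous_on I (delta g A)"
  shows "condition_ii I (I \<inter> {0..}) g"
proof -
  have "weakly_regular_on D (delta g A)" if D: "{0..1} \<subseteq> D" for D A
  proof (rule weakly_regular_on_if_bounded[of 0 1 _ _ "\<bar>delta g A 1\<bar>"])
    fix t :: real assume t: "0 \<le> t" "t \<le> 1"
    have "delta g A t = t * delta g A 1"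
    proof (cases "t = 0")
      case True
      then show ?thesis by (simp add: delta_def g)
    next
      case False
      then have "t > 0" "t * 1 \<in> I" "1 \<in> I" using t I by auto
      then have "delta g A (t * 1) = t * delta g A 1"
        using hom[of A] unfolding pos_homogeneous_on_def by blast
      then show ?thesis by simp
    qed
    also have "\<dots> \<le> t * \<bar>delta g A 1\<bar>" using t by (intro mult_left_mono) auto
    also have "\<dots> \<le> 1 * \<bar>delta g A 1\<bar>" using t by (intro mult_right_mono) auto
    finally show "delta g A t \<le> \<bar>delta g A 1\<bar>" by simp
  qed (use D in auto)
  then show ?thesis using I by (auto simp: condition_ii_def)
qed

theorem theorem6:
  fixes I :: "real set" and f f0 :: "real ^ 'n::{finite,linorder} \<Rightarrow> real"
  assumes "is_interval I"
    and "({0..1} \<subseteq> I \<and> I \<subseteq> {0..}) \<or> I = UNIV"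
    and "f0 = (\<lambda>x. f x - f 0)"
  shows "(lovasz_extension_on I f \<longleftrightarrow>
            condition_i I f0 \<and> condition_ii I (I \<inter> {0..}) f0) \<and>
         (I = UNIV \<longrightarrow>
            (lovasz_extension_on I f \<longleftrightarrow>
               condition_i I f0 \<and> condition_ii I (I \<inter> {..0}) f0)) \<and>
         (condition_i I f0 \<and> (\<forall>A. pos_homogeneous_on I (delta f0 A)) \<longrightarrow>
            condition_ii I (I \<inter> {0..}) f0)"
proof -
  have I01: "{0..1} \<subseteq> I" using assms(2) by auto
  have lov: "lovasz_extension_on I f \<longleftrightarrow> conewise_linear_on I f0"
    unfolding assms(3) using I01 by (rule lovasz_extension_on_iff_conewise_linear)
  have i: "condition_i I f0" if "conewise_linear_on I f0"
    using conewise_linear_imp_comonotonically_additive[OF that] by (simp add: condition_i_def)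
  have conv: "conewise_linear_on I f0"
    if "condition_i I f0" "condition_ii I J f0" "J = I \<inter> {0..} \<or> I = UNIV \<and> J = {..0}" for J
    using regular_condition_i_imp_conewise_linear[OF assms(1,2) that(1,3)] that(2)
    by (simp add: condition_ii_def)
  have "lovasz_extension_on I f \<longleftrightarrow> condition_i I f0 \<and> condition_ii I (I \<inter> {0..}) f0"
    unfolding lov using i conv conewise_linear_imp_condition_ii(1)[OF _ I01] by blast
  moreover have "lovasz_extension_on I f \<longleftrightarrow> condition_i I f0 \<and> condition_ii I (I \<inter> {..0}) f0"
    if "I = UNIV"
    unfolding lov using i conv[of "{..0}"] conewise_linear_imp_condition_ii(2)[OF _ I01] that by auto
  moreover have "condition_ii I (I \<inter> {0..}) f0" if "\<forall>A. pos_homogeneous_on I (delta f0 A)"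
    using pos_homogeneous_imp_condition_ii[OF I01, of f0] that by (simp add: assms(3))
  ultimately show ?thesis by blast
qed

end
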